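(* Let $S^2\subset\mathbb{R}^3$ be the unit sphere with the Euclidean metric, and let $\{\omega_N\}_{N\ge 2}$ be a sequence in which each $\omega_N$ is an $N$-point best-packing configuration on $S^2$. Then $$\gamma(\omega_N,S^2)\ge\frac{1}{2\cos(\pi/5)}+o(1)=\frac{2}{1+\sqrt5}+o(1),\qquad N\to\infty.$$
   Context: For a configuration $\omega_N=\{x_i\}_{i=1}^N\subset S^2$ of $N\ge2$ distinct points: the separation distance is $\delta(\omega_N):=\min_{i\ne j}|x_i-x_j|$; the mesh norm (covering radius) relative to $S^2$ is $\eta(\omega_N,S^2):=\max_{y\in S^2}\min_{1\le i\le N}|y-x_i|$; the mesh-separation ratio is $\gamma(\omega_N,S^2):=\eta(\omega_N,S^2)/\delta(\omega_N)$. Here $|\cdot|$ is the Euclidean norm in $\mathbb{R}^3$. $\omega_N$ is a best-packing configuration on $S^2$ if $\delta(\omega_N)=\delta_N(S^2):=\max\{\delta(\omega):\omega\subset S^2,\ \#\omega=N\}$. *)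

theory Defs
  imports "HOL-Analysis.Analysis" "HOL-Library.Landau_Symbols"
begin

text \<open>A configuration of \<open>N\<close> distinct points is a finite set of cardinality \<open>N\<close>;
  the definitions below are meant for \<open>N \<ge> 2\<close>, so that the minima are over nonempty finite sets.\<close>

definition separation :: "'a::metric_space set \<Rightarrow> real" where
  "separation \<omega> = Min {dist x y | x y. x \<in> \<omega> \<and> y \<in> \<omega> \<and> x \<noteq> y}"

text \<open>For compact nonempty \<open>A\<close> (such as the sphere) and finite nonempty \<open>\<omega>\<close> the supremum is
  attained, because the inner minimum is a continuous function of \<open>y\<close>.\<close>

definition mesh_norm :: "'a::metric_space set \<Rightarrow> 'a set \<Rightarrow> real" where
  "mesh_norm \<omega> A = (SUP y\<in>A. MIN x\<in>\<omega>. dist y x)"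

definition mesh_ratio :: "'a::metric_space set \<Rightarrow> 'a set \<Rightarrow> real" where
  "mesh_ratio \<omega> A = mesh_norm \<omega> A / separation \<omega>"

text \<open>The set of separations is bounded above when \<open>A\<close> is bounded, and nonempty when \<open>A\<close> has at
  least \<open>N\<close> points; whenever a best-packing configuration exists, this supremum is a maximum.
  For \<open>N \<ge> 2\<close> the condition \<open>card \<omega> = N\<close> includes finiteness of \<open>\<omega>\<close>.\<close>

definition best_separation :: "nat \<Rightarrow> 'a::metric_space set \<Rightarrow> real" where
  "best_separation N A = Sup {separation \<omega> | \<omega>. \<omega> \<subseteq> A \<and> card \<omega> = N}"

definition best_packing :: "nat \<Rightarrow> 'a::metric_space set \<Rightarrow> 'a set \<Rightarrow> bool" where
  "best_packing N A \<omega> \<longleftrightarrow> \<omega> \<subseteq> A \<and> card \<omega> = N \<and> separation \<omega> = best_separation N A"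

end

theory Submission
  imports Defs
begin

text \<open>Some point of the configuration touches at most five Voronoi vertices, since an average of six
  or more would contradict Euler's formula for the convex hull. Suppose that the bound fails, even up
  to a factor \<open>1 - \<eta>\<^sup>2 / 2\<close>, where \<open>\<eta>\<close> is the mesh norm and \<open>\<delta>\<close> the separation. Seen from a point
  \<open>v\<close> of the configuration, each Voronoi vertex is at distance at most about \<open>\<eta>\<close>, and the Voronoi cell
  contains a disc of radius about \<open>\<delta> / 2 > \<eta> * cos (pi / 5)\<close>. The vertex maximizing a linear
  functional on the cell is therefore within angle \<open>pi / 5\<close> of the direction of that functional, so the
  arcs of half-width less than \<open>pi / 5\<close> around the vertices cover all directions, and there are at
  least six of them.\<close>

section \<open>Voronoi vertices of a finite set on the sphere\<close>

text \<open>On the unit sphere the points of \<open>W\<close> closest to \<open>p\<close> are those maximizing \<open>p \<bullet> x\<close>.\<close>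

definition contact :: "'a::real_inner set \<Rightarrow> 'a \<Rightarrow> 'a set" where
  "contact W p = {x \<in> W. \<forall>y\<in>W. p \<bullet> y \<le> p \<bullet> x}"

text \<open>When every open hemisphere contains a point of the finite set \<open>W\<close> on the
  sphere, these are also the outer unit normals of the two-dimensional faces of its convex hull, and
  \<open>contact W p\<close> is the vertex set of the face with normal \<open>p\<close>.\<close>

definition voronoi_vertices :: "'a::real_inner set \<Rightarrow> 'a set" where
  "voronoi_vertices W = {p \<in> sphere 0 1. 3 \<le> card (contact W p)}"

lemma contactD:
  assumes "x \<in> contact W p"
  shows "x \<in> W" "y \<in> W \<Longrightarrow> p \<bullet> y \<le> p \<bullet> x"
  using assms by (auto simp: contact_def)

lemma contact_inner_eq:
  assumes "x \<in> contact W p" "y \<in> contact W p"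
  shows "p \<bullet> x = p \<bullet> y"
  using assms by (meson contactD order_antisym)

lemma contact_mem_iff:
  assumes "x \<in> contact W p" "y \<in> W"
  shows "y \<in> contact W p \<longleftrightarrow> p \<bullet> y = p \<bullet> x"
proof
  assume "y \<in> contact W p"
  then show "p \<bullet> y = p \<bullet> x" using assms(1) by (rule contact_inner_eq)
next
  assume "p \<bullet> y = p \<bullet> x"
  then show "y \<in> contact W p" using assms by (simp add: contact_def)
qed

lemma inner_unit_le:
  fixes x y :: "'a::real_inner"
  assumes "norm x = 1" "norm y = 1"
  shows "x \<bullet> y \<le> 1"
  using norm_cauchy_schwarz[of x y] assms by simp

lemma inner_unit_less:
  fixes x y :: "'a::real_inner"
  assumes "norm x = 1" "norm y = 1" "x \<noteq> y"
  shows "x \<bullet> y < 1"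
proof -
  have "0 < (norm (x - y))\<^sup>2"
    using assms by simp
  also have "\<dots> = 2 - 2 * (x \<bullet> y)"
    using assms by (simp add: power2_norm_eq_inner algebra_simps inner_commute norm_eq_1)
  finally show ?thesis by simp
qed

text \<open>A line meets the sphere in at most two points: on the line through \<open>x\<close> and
  \<open>y\<close>, the quadratic equation for the parameter \<open>c\<close> has only the roots 0
  and 1.\<close>

lemma cross_sphere_nonzero:
  fixes x y z :: "real^3"
  assumes "norm x = 1" "norm y = 1" "norm z = 1" "x \<noteq> y" "x \<noteq> z" "y \<noteq> z"
  shows "cross3 (y - x) (z - x) \<noteq> 0"
proof
  assume "cross3 (y - x) (z - x) = 0"
  then obtain c where c: "z - x = c *\<^sub>R (y - x)"
    using assms by (auto simp: cross_eq_0 collinear_lemma)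
  define d where "d = y - x"
  have y: "y = x + d" and z: "z = x + c *\<^sub>R d"
    using c by (simp_all add: d_def algebra_simps)
  have d: "2 * (x \<bullet> d) + d \<bullet> d = 0"
    using assms(1,2) by (simp add: y norm_eq_1 inner_simps inner_commute)
  have "2 * c * (x \<bullet> d) + c\<^sup>2 * (d \<bullet> d) = 0"
    using assms(1,3) by (simp add: z norm_eq_1 inner_simps inner_commute power2_eq_square)
  then have "c * (c - 1) * (d \<bullet> d) = 0"
    using d by algebra
  moreover have "c \<noteq> 0" "c \<noteq> 1" "d \<noteq> 0"
    using assms y z by auto
  ultimately show False by simp
qed

lemma cross_eq_0_of_orthogonal:
  fixes p a b :: "real^3"
  assumes "p \<bullet> a = 0" "p \<bullet> b = 0"
  shows "cross3 (cross3 a b) p = 0"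
  using assms cross_skew[of "cross3 a b" p] by (simp add: Lagrange)

lemma parallel_to_cross:
  fixes p a b :: "real^3"
  assumes "cross3 a b \<noteq> 0" "p \<bullet> a = 0" "p \<bullet> b = 0"
  obtains c where "p = c *\<^sub>R cross3 a b"
proof (cases "p = 0")
  case True
  then show ?thesis using that[of 0] by simp
next
  case False
  then show ?thesis
    using that cross_eq_0_of_orthogonal[OF assms(2,3)] assms(1)
    by (auto simp: cross_eq_0 collinear_lemma)
qed

lemma contact_positive:
  assumes pos: "\<And>p. norm p = 1 \<Longrightarrow> \<exists>x\<in>W. 0 < p \<bullet> x"
    and "norm p = 1" "x \<in> contact W p"
  shows "0 < p \<bullet> x"
  using pos[OF assms(2)] contactD(2)[OF assms(3)] by fastforce

text \<open>Both \<open>p\<close> and \<open>q\<close> are unit normals of the plane through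
  \<open>x\<close>, \<open>y\<close>, \<open>z\<close>, so they agree up to sign; the positive inner
  products with \<open>x\<close> fix the sign.\<close>

lemma contact_inj:
  fixes W :: "(real^3) set"
  assumes W: "W \<subseteq> sphere 0 1"
    and pos: "\<And>p. norm p = 1 \<Longrightarrow> \<exists>x\<in>W. 0 < p \<bullet> x"
    and p: "norm p = 1" "x \<in> contact W p" "y \<in> contact W p" "z \<in> contact W p"
    and q: "norm q = 1" "x \<in> contact W q" "y \<in> contact W q" "z \<in> contact W q"
    and ne: "x \<noteq> y" "x \<noteq> z" "y \<noteq> z"
  shows "p = q"
proof -
  let ?n = "cross3 (y - x) (z - x)"
  have "x \<in> W" "y \<in> W" "z \<in> W"
    using contactD(1) p by blast+
  then have "norm x = 1" "norm y = 1" "norm z = 1"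
    using W by auto
  then have n: "?n \<noteq> 0"
    using ne cross_sphere_nonzero by blast
  have "p \<bullet> (y - x) = 0" "p \<bullet> (z - x) = 0" "q \<bullet> (y - x) = 0" "q \<bullet> (z - x) = 0"
    using contact_inner_eq[OF p(2,3)] contact_inner_eq[OF p(2,4)]
      contact_inner_eq[OF q(2,3)] contact_inner_eq[OF q(2,4)]
    by (simp_all add: inner_diff_right)
  then obtain a b where ab: "p = a *\<^sub>R ?n" "q = b *\<^sub>R ?n"
    using parallel_to_cross[OF n] by metis
  have "\<bar>a\<bar> * norm ?n = \<bar>b\<bar> * norm ?n"
    using p(1) q(1) by (simp add: ab)
  then have "\<bar>a\<bar> = \<bar>b\<bar>" using n by simp
  then have "p = q \<or> p = - q"
    by (auto simp: ab abs_eq_iff)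
  moreover have "0 < p \<bullet> x" "0 < q \<bullet> x"
    using contact_positive[OF pos] p q by blast+
  ultimately show ?thesis by auto
qed

lemma obtain_three_of_card:
  assumes "3 \<le> card A"
  obtains x y z where "x \<in> A" "y \<in> A" "z \<in> A" "x \<noteq> y" "x \<noteq> z" "y \<noteq> z"
proof -
  obtain T where "T \<subseteq> A" "card T = 3"
    using obtain_subset_with_card_n[OF assms] by blast
  then show ?thesis
    using that by (auto simp: card_3_iff)
qed

text \<open>A Voronoi vertex is determined by any three of its contact points, hence by its contact
  set, and \<open>W\<close> has only finitely many subsets.\<close>

lemma finite_voronoi_vertices:
  fixes W :: "(real^3) set"
  assumes "finite W" "W \<subseteq> sphere 0 1"
    and pos: "\<And>p. norm p = 1 \<Longrightarrow> \<exists>x\<in>W. 0 < p \<bullet> x"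
  shows "finite (voronoi_vertices W)"
proof (rule finite_imageD)
  have "contact W ` voronoi_vertices W \<subseteq> Pow W"
    by (auto simp: contact_def)
  then show "finite (contact W ` voronoi_vertices W)"
    using assms(1) by (meson finite_Pow_iff finite_subset)
  show "inj_on (contact W) (voronoi_vertices W)"
  proof (rule inj_onI)
    fix p q
    assume p: "p \<in> voronoi_vertices W" and q: "q \<in> voronoi_vertices W"
      and eq: "contact W p = contact W q"
    obtain x y z where "x \<in> contact W p" "y \<in> contact W p" "z \<in> contact W p"
      "x \<noteq> y" "x \<noteq> z" "y \<noteq> z"
      using obtain_three_of_card p unfolding voronoi_vertices_def by blast
    then show "p = q"
      using contact_inj[OF assms(2) pos] p q eq by (simp add: voronoi_vertices_def)
  qed
qed

section \<open>Some point has at most five Voronoi vertices\<close>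

text \<open>Each pair of distinct points excludes only a hyperplane of functionals, and finitely
  many hyperplanes do not fill the space.\<close>

lemma generic_direction:
  fixes W :: "'a::euclidean_space set"
  assumes "finite W"
  obtains h where "inj_on (\<lambda>x. h \<bullet> x) W"
proof -
  let ?B = "\<Union>(x,y)\<in>{(x,y). x \<in> W \<and> y \<in> W \<and> x \<noteq> y}. {h. (x - y) \<bullet> h = 0}"
  have "finite {(x,y). x \<in> W \<and> y \<in> W \<and> x \<noteq> y}"
    by (rule finite_subset[of _ "W \<times> W"]) (use assms in auto)
  then have "negligible ?B"
    by (intro negligible_Union) (auto intro!: negligible_hyperplane)
  then have "?B \<noteq> UNIV"
    using non_negligible_UNIV by metis
  then obtain h where "h \<notin> ?B" by blast
  then have "inj_on (\<lambda>x. h \<bullet> x) W"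
    by (auto simp: inj_on_def inner_diff_left inner_commute[of h])
  then show ?thesis by (rule that)
qed

section \<open>Faces of the convex hull cut by a level plane of a linear functional\<close>

lemma level_crossing_direction:
  fixes h v y z :: "'a::real_inner"
  assumes unit: "norm v = 1" "norm y = 1" "norm z = 1"
    and lt: "h \<bullet> y < h \<bullet> v" "h \<bullet> v < h \<bullet> z"
  obtains a b where "0 < a" "0 < b"
    "h \<bullet> (a *\<^sub>R (y - v) + b *\<^sub>R (z - v)) = 0"
    "v \<bullet> (a *\<^sub>R (y - v) + b *\<^sub>R (z - v)) = - 1"
proof -
  \<comment> \<open>Each weight is the height difference of the opposite point, so the combination
    has height 0; dividing by \<open>s\<close> normalizes its component along \<open>v\<close> to
    -1.\<close>
  define a b where "a = h \<bullet> z - h \<bullet> v" and "b = h \<bullet> v - h \<bullet> y"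
  define s where "s = a * (1 - v \<bullet> y) + b * (1 - v \<bullet> z)"
  have ab: "0 < a" "0 < b" using lt by (auto simp: a_def b_def)
  have "v \<bullet> y < 1" "v \<bullet> z < 1"
    using unit lt by (auto intro!: inner_unit_less)
  then have s: "0 < s"
    unfolding s_def using ab by (intro add_pos_pos mult_pos_pos) auto
  have vv: "v \<bullet> v = 1" using unit by (simp add: norm_eq_1)
  show ?thesis
  proof (rule that[of "a / s" "b / s"])
    have "h \<bullet> ((a / s) *\<^sub>R (y - v) + (b / s) *\<^sub>R (z - v))
        = (a * (h \<bullet> y - h \<bullet> v) + b * (h \<bullet> z - h \<bullet> v)) / s"
      by (simp add: inner_simps add_divide_distrib)
    also have "\<dots> = 0"
      by (simp add: a_def b_def algebra_simps)
    finally show "h \<bullet> ((a / s) *\<^sub>R (y - v) + (b / s) *\<^sub>R (z - v)) = 0" .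
    have "v \<bullet> ((a / s) *\<^sub>R (y - v) + (b / s) *\<^sub>R (z - v))
        = (a * (v \<bullet> y - 1) + b * (v \<bullet> z - 1)) / s"
      by (simp add: inner_simps add_divide_distrib vv)
    also have "a * (v \<bullet> y - 1) + b * (v \<bullet> z - 1) = - s"
      by (simp add: s_def algebra_simps)
    finally show "v \<bullet> ((a / s) *\<^sub>R (y - v) + (b / s) *\<^sub>R (z - v)) = - 1"
      using s by simp
  qed (use ab s in auto)
qed

text \<open>The vanishing value is a positive combination of two nonpositive terms, so both vanish.
  Then \<open>q\<close> also touches \<open>y\<close> and \<open>z\<close>, and three common contact
  points determine the vertex.\<close>

lemma supporting_eq_at_crossing:
  fixes W :: "(real^3) set"
  assumes W: "W \<subseteq> sphere 0 1"
    and pos: "\<And>p. norm p = 1 \<Longrightarrow> \<exists>x\<in>W. 0 < p \<bullet> x"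
    and p: "norm p = 1" "v \<in> contact W p" "y \<in> contact W p" "z \<in> contact W p"
    and q: "norm q = 1" "v \<in> contact W q"
    and ne: "v \<noteq> y" "v \<noteq> z" "y \<noteq> z"
    and ab: "0 < a" "0 < b"
    and zero: "q \<bullet> (a *\<^sub>R (y - v) + b *\<^sub>R (z - v)) = 0"
  shows "p = q"
proof -
  have yz: "y \<in> W" "z \<in> W" using p contactD(1) by auto
  have le: "q \<bullet> y \<le> q \<bullet> v" "q \<bullet> z \<le> q \<bullet> v"
    using contactD(2)[OF q(2)] yz by auto
  have "a * (q \<bullet> v - q \<bullet> y) + b * (q \<bullet> v - q \<bullet> z) = 0"
    using zero by (simp add: inner_simps algebra_simps)
  moreover have "0 \<le> a * (q \<bullet> v - q \<bullet> y)" "0 \<le> b * (q \<bullet> v - q \<bullet> z)"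
    using ab le by auto
  ultimately have "a * (q \<bullet> v - q \<bullet> y) = 0" "b * (q \<bullet> v - q \<bullet> z) = 0" by linarith+
  then have "y \<in> contact W q" "z \<in> contact W q"
    using ab yz contact_mem_iff[OF q(2)] by auto
  then show ?thesis
    using contact_inj[OF W pos p q(1,2)] ne by blast
qed

text \<open>A weighted mean of two nonpositive numbers vanishes only if every term with nonzero
  weight does, and at least one of the two weights is nonzero.\<close>

lemma supporting_between:
  fixes d1 d2 d3 q :: "'a::euclidean_space"
  assumes "between (d1, d3) d2" "q \<bullet> d2 = 0" "q \<bullet> d1 \<le> 0" "q \<bullet> d3 \<le> 0"
  shows "q \<bullet> d1 = 0 \<or> q \<bullet> d3 = 0"
proof -
  obtain u where u: "0 \<le> u" "u \<le> 1" "d2 = (1 - u) *\<^sub>R d1 + u *\<^sub>R d3"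
    using assms(1) by (auto simp: between_mem_segment in_segment)
  then have "(1 - u) * (q \<bullet> d1) + u * (q \<bullet> d3) = 0"
    using assms(2) by (simp add: inner_simps)
  moreover have "(1 - u) * (q \<bullet> d1) \<le> 0" "u * (q \<bullet> d3) \<le> 0"
    using u assms by (auto simp: mult_nonneg_nonpos)
  ultimately have "(1 - u) * (q \<bullet> d1) = 0" "u * (q \<bullet> d3) = 0" by linarith+
  then show ?thesis by auto
qed

text \<open>Differences of the points are orthogonal to both \<open>h\<close> and \<open>v\<close>,
  hence multiples of \<open>cross3 h v\<close>.\<close>

lemma collinear_of_two_functionals:
  fixes h v a b c :: "real^3"
  assumes "cross3 h v \<noteq> 0"
    and "h \<bullet> a = s" "h \<bullet> b = s" "h \<bullet> c = s"
    and "v \<bullet> a = t" "v \<bullet> b = t" "v \<bullet> c = t"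
  shows "collinear {a, b, c}"
proof -
  have "\<exists>k. x - y = k *\<^sub>R cross3 h v" if "x \<in> {a,b,c}" "y \<in> {a,b,c}" for x y
  proof -
    have "h \<bullet> x = s" "h \<bullet> y = s" "v \<bullet> x = t" "v \<bullet> y = t"
      using that assms(2-) by blast+
    then have "(x - y) \<bullet> h = 0" "(x - y) \<bullet> v = 0"
      by (simp_all add: inner_diff_left inner_diff_right inner_commute)
    then show ?thesis
      using parallel_to_cross[OF assms(1)] by metis
  qed
  then show ?thesis unfolding collinear_def by blast
qed

definition middle_contact :: "'a::real_inner \<Rightarrow> 'a set \<Rightarrow> 'a \<Rightarrow> 'a \<Rightarrow> bool" where
  "middle_contact h W v p \<longleftrightarrow> v \<in> contact W p \<and>
     (\<exists>y\<in>contact W p. h \<bullet> y < h \<bullet> v) \<and> (\<exists>z\<in>contact W p. h \<bullet> v < h \<bullet> z)"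

text \<open>The plane \<open>h \<bullet> x = h \<bullet> v\<close> cuts each of the three faces along a segment from \<open>v\<close>.
  Scaled to height \<open>-1\<close> along \<open>v\<close>, the three directions are collinear, and the plane supporting the
  face of the middle one contains one of the other two.\<close>

lemma middle_contact_three:
  fixes W :: "(real^3) set"
  assumes W: "W \<subseteq> sphere 0 1"
    and pos: "\<And>p. norm p = 1 \<Longrightarrow> \<exists>x\<in>W. 0 < p \<bullet> x"
    and unit: "norm p1 = 1" "norm p2 = 1" "norm p3 = 1"
    and mid: "middle_contact h W v p1" "middle_contact h W v p2" "middle_contact h W v p3"
  shows "p1 = p2 \<or> p1 = p3 \<or> p2 = p3"
proof -
  have v: "v \<in> contact W p1" "v \<in> contact W p2" "v \<in> contact W p3"
    using mid by (auto simp: middle_contact_def)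
  have nv: "norm v = 1" using contactD(1)[OF v(1)] W by auto
  \<comment> \<open>The vector \<open>d\<close> points from \<open>v\<close> along the segment in
    which the level plane cuts the face of \<open>p\<close>. Every supporting plane at
    \<open>v\<close> has it on its inner side, and only the plane of that face contains it.\<close>
  have ex: "\<exists>d. h \<bullet> d = 0 \<and> v \<bullet> d = - 1 \<and> p \<bullet> d = 0 \<and>
      (\<forall>q. norm q = 1 \<and> v \<in> contact W q \<longrightarrow> q \<bullet> d \<le> 0 \<and> (q \<bullet> d = 0 \<longrightarrow> p = q))"
    if p: "norm p = 1" and m: "middle_contact h W v p" for p
  proof -
    obtain y z where yz: "y \<in> contact W p" "z \<in> contact W p" "h \<bullet> y < h \<bullet> v" "h \<bullet> v < h \<bullet> z"
      and vp: "v \<in> contact W p"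
      using m by (auto simp: middle_contact_def)
    have inW: "y \<in> W" "z \<in> W"
      using yz contactD(1) by blast+
    then have n: "norm y = 1" "norm z = 1"
      using W by auto
    have ne: "v \<noteq> y" "v \<noteq> z" "y \<noteq> z" using yz by auto
    obtain a b where ab: "0 < a" "0 < b"
      "h \<bullet> (a *\<^sub>R (y - v) + b *\<^sub>R (z - v)) = 0"
      "v \<bullet> (a *\<^sub>R (y - v) + b *\<^sub>R (z - v)) = - 1"
      using level_crossing_direction[OF nv n yz(3,4)] by blast
    let ?d = "a *\<^sub>R (y - v) + b *\<^sub>R (z - v)"
    have le: "q \<bullet> ?d \<le> 0" if "v \<in> contact W q" for q
    proof -
      have "a * (q \<bullet> (y - v)) \<le> 0" "b * (q \<bullet> (z - v)) \<le> 0"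
        using ab inW contactD(2)[OF that] by (auto simp: inner_diff_right mult_nonneg_nonpos)
      then show ?thesis by (simp add: inner_add_right)
    qed
    have zero: "p \<bullet> ?d = 0"
      using contact_inner_eq[OF vp yz(1)] contact_inner_eq[OF vp yz(2)]
      by (simp add: inner_simps)
    have "p = q" if "norm q = 1" "v \<in> contact W q" "q \<bullet> ?d = 0" for q
      by (rule supporting_eq_at_crossing[OF W pos p vp yz(1,2) that(1,2) ne ab(1,2) that(3)])
    then show ?thesis
      using ab(3,4) le zero by blast
  qed
  obtain d1 where d1: "h \<bullet> d1 = 0" "v \<bullet> d1 = - 1" "p1 \<bullet> d1 = 0"
    "\<And>q. norm q = 1 \<Longrightarrow> v \<in> contact W q \<Longrightarrow> q \<bullet> d1 \<le> 0"
    "\<And>q. norm q = 1 \<Longrightarrow> v \<in> contact W q \<Longrightarrow> q \<bullet> d1 = 0 \<Longrightarrow> p1 = q"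
    using ex[OF unit(1) mid(1)] by blast
  obtain d2 where d2: "h \<bullet> d2 = 0" "v \<bullet> d2 = - 1" "p2 \<bullet> d2 = 0"
    "\<And>q. norm q = 1 \<Longrightarrow> v \<in> contact W q \<Longrightarrow> q \<bullet> d2 \<le> 0"
    "\<And>q. norm q = 1 \<Longrightarrow> v \<in> contact W q \<Longrightarrow> q \<bullet> d2 = 0 \<Longrightarrow> p2 = q"
    using ex[OF unit(2) mid(2)] by blast
  obtain d3 where d3: "h \<bullet> d3 = 0" "v \<bullet> d3 = - 1" "p3 \<bullet> d3 = 0"
    "\<And>q. norm q = 1 \<Longrightarrow> v \<in> contact W q \<Longrightarrow> q \<bullet> d3 \<le> 0"
    "\<And>q. norm q = 1 \<Longrightarrow> v \<in> contact W q \<Longrightarrow> q \<bullet> d3 = 0 \<Longrightarrow> p3 = q"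
    using ex[OF unit(3) mid(3)] by blast
  have hv: "cross3 h v \<noteq> 0"
  proof
    assume "cross3 h v = 0"
    then have "cross3 v h = 0" using cross_skew[of v h] by simp
    moreover have "v \<noteq> 0" using nv by auto
    moreover obtain y where "h \<bullet> y < h \<bullet> v"
      using mid(1) by (auto simp: middle_contact_def)
    then have "h \<noteq> 0" by auto
    ultimately obtain c where c: "h = c *\<^sub>R v" "c \<noteq> 0"
      by (auto simp: cross_eq_0 collinear_lemma)
    then show False using d1(1,2) by simp
  qed
  have "collinear {d1, d2, d3}"
    using collinear_of_two_functionals[OF hv] d1 d2 d3 by blast
  then consider "between (d2, d3) d1" | "between (d3, d1) d2" | "between (d1, d2) d3"
    by (auto simp: collinear_between_cases)
  then show ?thesis
  proof cases
    case 1
    then show ?thesis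
      using supporting_between[OF 1 d1(3)] d2(4,5)[OF unit(1) v(1)] d3(4,5)[OF unit(1) v(1)] by blast
  next
    case 2
    then show ?thesis
      using supporting_between[OF 2 d2(3)] d1(4,5)[OF unit(2) v(2)] d3(4,5)[OF unit(2) v(2)] by blast
  next
    case 3
    then show ?thesis
      using supporting_between[OF 3 d3(3)] d1(4,5)[OF unit(3) v(3)] d2(4,5)[OF unit(3) v(3)] by blast
  qed
qed

lemma card_middle_contact_le:
  fixes W :: "(real^3) set"
  assumes W: "W \<subseteq> sphere 0 1"
    and pos: "\<And>p. norm p = 1 \<Longrightarrow> \<exists>x\<in>W. 0 < p \<bullet> x"
  shows "card {p \<in> voronoi_vertices W. middle_contact h W v p} \<le> 2"
proof (rule ccontr)
  assume "\<not> ?thesis"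
  then have "3 \<le> card {p \<in> voronoi_vertices W. middle_contact h W v p}" by simp
  then obtain p q r where pqr: "p \<in> {p \<in> voronoi_vertices W. middle_contact h W v p}"
    "q \<in> {p \<in> voronoi_vertices W. middle_contact h W v p}"
    "r \<in> {p \<in> voronoi_vertices W. middle_contact h W v p}"
    and ne: "p \<noteq> q" "p \<noteq> r" "q \<noteq> r"
    by (rule obtain_three_of_card)
  then have "norm p = 1" "norm q = 1" "norm r = 1"
    "middle_contact h W v p" "middle_contact h W v q" "middle_contact h W v r"
    by (auto simp: voronoi_vertices_def)
  from middle_contact_three[OF W pos this] ne show False by blast
qed

text \<open>Since \<open>h\<close> is injective on \<open>W\<close>, only one lowest and one highest
  contact point fail to be middle ones.\<close>

lemma card_contact_le_middle:
  fixes W :: "'a::real_inner set"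
  assumes "finite W" "inj_on (\<lambda>x. h \<bullet> x) W"
  shows "card (contact W p) \<le> card {v \<in> W. middle_contact h W v p} + 2"
proof (cases "contact W p = {}")
  case False
  let ?A = "contact W p"
  have sub: "?A \<subseteq> W" by (auto simp: contact_def)
  then have fin: "finite ?A" using assms(1) finite_subset by blast
  have im: "finite ((\<lambda>x. h \<bullet> x) ` ?A)" "(\<lambda>x. h \<bullet> x) ` ?A \<noteq> {}"
    using fin False by auto
  obtain lo where lo: "lo \<in> ?A" "\<And>x. x \<in> ?A \<Longrightarrow> h \<bullet> lo \<le> h \<bullet> x"
    using Min_in[OF im] Min_le[OF im(1)] by force
  obtain hi where hi: "hi \<in> ?A" "\<And>x. x \<in> ?A \<Longrightarrow> h \<bullet> x \<le> h \<bullet> hi"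
    using Max_in[OF im] Max_ge[OF im(1)] by force
  have "?A - {lo, hi} \<subseteq> {v \<in> W. middle_contact h W v p}"
  proof
    fix v assume v: "v \<in> ?A - {lo, hi}"
    then have "h \<bullet> lo \<noteq> h \<bullet> v" "h \<bullet> hi \<noteq> h \<bullet> v"
      using assms(2) sub lo(1) hi(1) by (auto dest: inj_onD)
    then have "h \<bullet> lo < h \<bullet> v" "h \<bullet> v < h \<bullet> hi"
      using v lo(2)[of v] hi(2)[of v] by auto
    then show "v \<in> {v \<in> W. middle_contact h W v p}"
      using v lo(1) hi(1) sub by (auto simp: middle_contact_def)
  qed
  then have "card (?A - {lo, hi}) \<le> card {v \<in> W. middle_contact h W v p}"
    using assms(1) by (intro card_mono) auto
  moreover have "card ?A \<le> card (?A - {lo, hi}) + card {lo, hi}"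
    using diff_card_le_card_Diff[of "{lo, hi}" ?A] by simp
  moreover have "card {lo, hi} \<le> 2"
    by (simp add: card_insert_if)
  ultimately show ?thesis by linarith
qed simp

lemma sum_card_swap:
  assumes "finite A" "finite B"
  shows "(\<Sum>a\<in>A. card {b \<in> B. R a b}) = (\<Sum>b\<in>B. card {a \<in> A. R a b})"
  using sum_multicount_gen[OF assms, of R "\<lambda>b. card {a \<in> A. R a b}"] by simp

text \<open>Replaces Euler's formula. With respect to a generic linear functional a face with \<open>k\<close>
  vertices has \<open>k - 2 \<ge> k / 3\<close> vertices that are neither its highest nor its lowest one, while a
  point is such a middle vertex of at most two faces, and the top point of none.\<close>

proposition few_voronoi_vertices:
  fixes W :: "(real^3) set"
  assumes fin: "finite W" and ne: "W \<noteq> {}" and W: "W \<subseteq> sphere 0 1"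
    and pos: "\<And>p. norm p = 1 \<Longrightarrow> \<exists>x\<in>W. 0 < p \<bullet> x"
  obtains v where "v \<in> W" "card {p \<in> voronoi_vertices W. v \<in> contact W p} \<le> 5"
proof (rule ccontr)
  assume "\<not> thesis"
  then have six: "6 \<le> card {p \<in> voronoi_vertices W. v \<in> contact W p}" if "v \<in> W" for v
    using that \<open>\<And>v. v \<in> W \<Longrightarrow> _ \<Longrightarrow> thesis\<close> by force
  let ?V = "voronoi_vertices W"
  have finV: "finite ?V" by (rule finite_voronoi_vertices[OF fin W pos])
  obtain h where h: "inj_on (\<lambda>x. h \<bullet> x) W" using generic_direction[OF fin] .
  have im: "finite ((\<lambda>x. h \<bullet> x) ` W)" "(\<lambda>x. h \<bullet> x) ` W \<noteq> {}" using fin ne by auto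
  obtain top where top: "top \<in> W" "\<And>x. x \<in> W \<Longrightarrow> h \<bullet> x \<le> h \<bullet> top"
    using Max_in[OF im] Max_ge[OF im(1)] by force
  have "\<not> middle_contact h W top p" for p
    using top(2) contactD(1)[of _ W p] by (force simp: middle_contact_def)
  then have "(\<Sum>v\<in>W. card {p \<in> ?V. middle_contact h W v p})
      = (\<Sum>v\<in>W - {top}. card {p \<in> ?V. middle_contact h W v p})"
    using fin top(1) by (simp add: sum.remove)
  also have "\<dots> \<le> (\<Sum>v\<in>W - {top}. 2)"
    by (intro sum_mono card_middle_contact_le[OF W pos])
  finally have mid: "(\<Sum>v\<in>W. card {p \<in> ?V. middle_contact h W v p}) \<le> 2 * (card W - 1)"
    using top(1) by simp
  have "6 * card W = (\<Sum>v\<in>W. 6)" by simp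
  also have "\<dots> \<le> (\<Sum>v\<in>W. card {p \<in> ?V. v \<in> contact W p})"
    by (intro sum_mono six)
  also have "\<dots> = (\<Sum>p\<in>?V. card {v \<in> W. v \<in> contact W p})"
    by (rule sum_card_swap[OF fin finV])
  also have "\<dots> \<le> (\<Sum>p\<in>?V. 3 * card {v \<in> W. middle_contact h W v p})"
  proof (rule sum_mono)
    fix p assume "p \<in> ?V"
    then have "3 \<le> card (contact W p)" by (simp add: voronoi_vertices_def)
    moreover have "{v \<in> W. v \<in> contact W p} = contact W p" by (auto simp: contact_def)
    ultimately show "card {v \<in> W. v \<in> contact W p} \<le> 3 * card {v \<in> W. middle_contact h W v p}"
      using card_contact_le_middle[OF fin h, of p] by simp
  qed
  also have "\<dots> = 3 * (\<Sum>p\<in>?V. card {v \<in> W. middle_contact h W v p})"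
    by (simp add: sum_distrib_left)
  also have "\<dots> = 3 * (\<Sum>v\<in>W. card {p \<in> ?V. middle_contact h W v p})"
    by (simp add: sum_card_swap[OF fin finV])
  \<comment> \<open>The chain gives \<open>6 * card W \<le> 6 * (card W - 1)\<close>; as
    \<open>W\<close> is nonempty, the subtraction is not truncated.\<close>
  finally show False
    using mid card_gt_0_iff[of W] fin ne by auto
qed

section \<open>Every point of a well-distributed set has at least six Voronoi vertices\<close>

lemma cos_2pi_5: "cos (2 * pi / 5) = 2 * (cos (pi / 5))\<^sup>2 - 1"
  using cos_double_cos[of "pi / 5"] by simp

text \<open>The multiples 1 and 2 lie in the interval from 0 to pi, where cosine decreases;
  reflection at pi carries 4 and 3 to them.\<close>

lemma cos_multiple_2pi_5_le:
  assumes "k \<in> {1..4::nat}"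
  shows "cos (2 * pi / 5 * k) \<le> cos (2 * pi / 5)"
proof -
  have le: "cos (2 * pi / 5 * k) \<le> cos (2 * pi / 5)" if "k \<in> {1..2::nat}" for k
    using that by (intro cos_monotone_0_pi_le) (auto simp: field_simps)
  have refl: "cos (2 * pi / 5 * real k) = cos (2 * pi / 5 * real (5 - k))" if "k \<le> 5" for k
  proof -
    have "2 * pi / 5 * real (5 - k) = 2 * pi - 2 * pi / 5 * real k"
      using that by (simp add: of_nat_diff field_simps)
    then show ?thesis by (simp only: cos_2pi_minus)
  qed
  show ?thesis
  proof (cases "k \<le> 2")
    case True
    then show ?thesis using assms le[of k] by simp
  next
    case False
    then have "5 - k \<in> {1..2}" "k \<le> 5" using assms by auto
    then show ?thesis using le[of "5 - k"] refl[of k] by simp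
  qed
qed

text \<open>Of the five rotations of a point by multiples of \<open>2 * pi / 5\<close> no two lie in the same set,
  so the closed sets \<open>T i\<close> would have to be pairwise disjoint, against connectedness.\<close>

lemma circle_not_covered:
  fixes T :: "'i \<Rightarrow> real set"
  assumes I: "finite I" "card I \<le> 5"
    and closed: "\<And>i. i \<in> I \<Longrightarrow> closed (T i)"
    and cover: "\<And>t. \<exists>i\<in>I. t \<in> T i"
    and small: "\<And>i s t. i \<in> I \<Longrightarrow> s \<in> T i \<Longrightarrow> t \<in> T i \<Longrightarrow> cos (2 * pi / 5) < cos (s - t)"
  shows False
proof -
  let ?r = "2 * pi / 5"
  have disj: "T i \<inter> T j = {}" if ij: "i \<in> I" "j \<in> I" "i \<noteq> j" for i j
  proof (rule ccontr)
    assume "T i \<inter> T j \<noteq> {}"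
    then obtain t where t: "t \<in> T i" "t \<in> T j" by blast
    have "\<forall>k::nat. \<exists>i. i \<in> I \<and> t + ?r * k \<in> T i"
      using cover by blast
    then obtain f where f: "\<And>k::nat. f k \<in> I" "\<And>k. t + ?r * k \<in> T (f k)"
      by metis
    \<comment> \<open>The point \<open>t\<close> already occupies the two indices \<open>i\<close>
      and \<open>j\<close>; its four further rotations need four other distinct indices, which makes
      six.\<close>
    have far: "f k \<noteq> i \<and> f k \<noteq> j" if "k \<in> {1..4}" for k
      using small[OF f(1) f(2)[of k], of t] t cos_multiple_2pi_5_le[OF that] by force
    have "inj_on f {1..4}"
    proof (rule linorder_inj_onI)
      fix k l :: nat assume kl: "k < l" "k \<in> {1..4}" "l \<in> {1..4}"
      then have "(t + ?r * l) - (t + ?r * k) = ?r * real (l - k)"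
        by (simp add: of_nat_diff algebra_simps)
      moreover have "cos (?r * real (l - k)) \<le> cos ?r"
        using kl by (intro cos_multiple_2pi_5_le) auto
      ultimately have "\<not> cos ?r < cos ((t + ?r * l) - (t + ?r * k))" by (simp only: not_less)
      then have "t + ?r * k \<notin> T (f l)"
        using small[OF f(1) f(2)] by blast
      then show "f k \<noteq> f l" using f(2)[of k] by metis
    qed auto
    moreover have "f ` {1..4} \<subseteq> I - {i, j}"
      using far f(1) by blast
    ultimately have "card {1..4::nat} \<le> card (I - {i, j})"
      using I by (intro card_inj_on_le[of f]) auto
    then show False
      using ij I by simp
  qed
  obtain i where i: "i \<in> I" "0 \<in> T i" using cover by blast
  \<comment> \<open>The complement of \<open>T i\<close> is a finite union of closed sets, so
    \<open>T i\<close> is clopen and equals the whole line. It then contains both 0 and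
    \<open>2 * pi / 5\<close>, which is too large a gap.\<close>
  have "- T i = (\<Union>j\<in>I - {i}. T j)"
    using cover disj i(1) by blast
  moreover have "closed (\<Union>j\<in>I - {i}. T j)"
    using I closed by (intro closed_UN) auto
  ultimately have "open (T i)"
    by (simp add: open_closed)
  then have "T i = UNIV"
    using clopen closed[OF i(1)] i(2) by blast
  then show False
    using small[OF i(1), of ?r 0] by simp
qed

section \<open>The tangent plane and the gnomonic Voronoi cell\<close>

lemma orthonormal_pair_orthogonal:
  fixes v :: "real^3"
  assumes "norm v = 1"
  obtains e f where "norm e = 1" "norm f = 1" "e \<bullet> f = 0" "e \<bullet> v = 0" "f \<bullet> v = 0"
proof -
  obtain y where y: "y \<noteq> 0" "orthogonal v y"
    using orthogonal_to_vector_exists[of v] by auto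
  define e where "e = y /\<^sub>R norm y"
  have e: "norm e = 1" "e \<bullet> v = 0"
    using y by (auto simp: e_def orthogonal_def inner_commute)
  have "(norm (cross3 v e))\<^sup>2 = 1"
    using norm_cross_dot[of v e] e assms by (simp add: inner_commute)
  then have "norm (cross3 v e) = 1"
    using norm_ge_zero[of "cross3 v e"] by (simp add: power2_eq_1_iff)
  then show ?thesis
    using that[OF e(1) _ _ e(2)] by (simp add: dot_cross_self)
qed

text \<open>Bessel's inequality for two vectors.\<close>

lemma inner_orthonormal_pair_le:
  fixes u v x :: "'a::real_inner"
  assumes "norm u = 1" "norm v = 1" "u \<bullet> v = 0"
  shows "(u \<bullet> x)\<^sup>2 + (v \<bullet> x)\<^sup>2 \<le> (norm x)\<^sup>2"
proof -
  have "0 \<le> (norm (x - (u \<bullet> x) *\<^sub>R u - (v \<bullet> x) *\<^sub>R v))\<^sup>2"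
    by simp
  also have "\<dots> = (norm x)\<^sup>2 - (u \<bullet> x)\<^sup>2 - (v \<bullet> x)\<^sup>2"
    using assms unfolding power2_norm_eq_inner norm_eq_1
    by (simp add: inner_diff_left inner_diff_right inner_commute power2_eq_square algebra_simps)
  finally show ?thesis by simp
qed

lemma finite_positive_lower_bound:
  fixes f :: "'a \<Rightarrow> real"
  assumes "finite A" "\<And>x. x \<in> A \<Longrightarrow> 0 < f x"
  obtains e where "0 < e" "\<And>x. x \<in> A \<Longrightarrow> e \<le> f x"
proof
  \<comment> \<open>The inserted 1 keeps the minimum meaningful when \<open>A\<close> is
    empty.\<close>
  show "0 < Min (insert 1 (f ` A))" using assms by simp
  show "Min (insert 1 (f ` A)) \<le> f x" if "x \<in> A" for x
    using assms that by (intro Min_le) auto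
qed

lemma inner_unit_dist:
  fixes x y :: "'a::real_inner"
  assumes "norm x = 1" "norm y = 1"
  shows "x \<bullet> y = 1 - (dist x y)\<^sup>2 / 2"
  using assms unfolding dist_norm power2_norm_eq_inner norm_eq_1
  by (simp add: inner_diff_left inner_diff_right inner_commute field_simps)

text \<open>Gnomonic image of the Voronoi cell of \<open>v\<close>: the point \<open>v + g\<close> of the tangent plane at \<open>v\<close>
  is at least as close to \<open>v\<close> as to every other \<open>x \<in> W\<close>.\<close>

definition tangent_cell :: "'a::real_inner set \<Rightarrow> 'a \<Rightarrow> 'a set" where
  "tangent_cell W v = {g. v \<bullet> g = 0 \<and> (\<forall>x\<in>W. x \<bullet> g \<le> 1 - x \<bullet> v)}"

text \<open>Here \<open>p\<close> is the radial projection of \<open>v + g\<close> to the sphere.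
  The scaling is positive, so it preserves the comparison of inner products, and the tight
  constraints of the cell become contacts of \<open>p\<close>.\<close>

lemma tangent_cell_contact:
  fixes v :: "'a::real_inner"
  assumes "norm v = 1" "v \<in> W" "g \<in> tangent_cell W v"
  defines "p \<equiv> (v + g) /\<^sub>R norm (v + g)"
  shows "norm p = 1" "p \<bullet> v = 1 / norm (v + g)" "p /\<^sub>R (p \<bullet> v) - v = g"
    "contact W p = {x \<in> W. x \<bullet> g = 1 - x \<bullet> v}"
proof -
  have vv: "v \<bullet> v = 1" using assms(1) by (simp add: norm_eq_1)
  have vg: "(v + g) \<bullet> v = 1"
    using assms(3) vv by (simp add: tangent_cell_def inner_add_left inner_commute[of g v])
  then have "v + g \<noteq> 0" by auto
  then have n: "0 < norm (v + g)" by simp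
  then show "norm p = 1" by (simp add: p_def)
  show pv: "p \<bullet> v = 1 / norm (v + g)"
    using vg by (simp add: p_def divide_inverse)
  show "p /\<^sub>R (p \<bullet> v) - v = g"
    unfolding pv using n by (simp add: p_def)
  have px: "p \<bullet> x = (x \<bullet> v + x \<bullet> g) / norm (v + g)" for x
  proof -
    have "(v + g) \<bullet> x = x \<bullet> v + x \<bullet> g" by (metis inner_commute inner_add_right)
    then show ?thesis by (simp add: p_def divide_inverse)
  qed
  have "p \<bullet> x \<le> p \<bullet> v" if "x \<in> W" for x
  proof -
    have "x \<bullet> v + x \<bullet> g \<le> 1"
      using that assms(3) by (auto simp: tangent_cell_def)
    then show ?thesis
      unfolding pv px[of x] using n by (intro divide_right_mono) auto
  qed
  then have "v \<in> contact W p"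
    using assms(2) by (simp add: contact_def)
  then have "x \<in> contact W p \<longleftrightarrow> x \<in> W \<and> p \<bullet> x = p \<bullet> v" for x
    using contact_mem_iff[of v W p x] contactD(1)[of x W p] by auto
  moreover have "p \<bullet> x = p \<bullet> v \<longleftrightarrow> x \<bullet> g = 1 - x \<bullet> v" for x
    unfolding pv px[of x] using n by (auto simp: field_simps)
  ultimately show "contact W p = {x \<in> W. x \<bullet> g = 1 - x \<bullet> v}"
    by blast
qed

text \<open>Since \<open>v\<close> is a contact point of the projection \<open>p\<close>, covering
  gives \<open>\<kappa> \<le> p \<bullet> v = 1 / norm (v + g)\<close>, which bounds
  \<open>g\<close>.\<close>

lemma compact_tangent_cell:
  fixes W :: "'a::euclidean_space set"
  assumes "norm v = 1" "v \<in> W" "0 < \<kappa>"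
    and cover: "\<And>p. norm p = 1 \<Longrightarrow> \<exists>x\<in>W. \<kappa> \<le> p \<bullet> x"
  shows "compact (tangent_cell W v)"
proof -
  have "norm g \<le> 1 / \<kappa> + 1" if g: "g \<in> tangent_cell W v" for g
  proof -
    define p where "p = (v + g) /\<^sub>R norm (v + g)"
    note p = tangent_cell_contact[OF assms(1,2) g, folded p_def]
    obtain x where x: "x \<in> W" "\<kappa> \<le> p \<bullet> x" using cover[OF p(1)] by blast
    have "v \<in> contact W p"
      using p(4) assms(1,2) g by (simp add: tangent_cell_def norm_eq_1)
    then have "\<kappa> \<le> 1 / norm (v + g)"
      using contactD(2)[OF _ x(1)] x(2) p(2) by fastforce
    then have "norm (v + g) \<le> 1 / \<kappa>"
      using assms(3) p(1)
      by (cases "v + g = 0") (auto simp: p_def field_simps)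
    moreover have "norm g \<le> norm (v + g) + norm v"
      using norm_triangle_ineq4[of "v + g" v] by simp
    ultimately show ?thesis using assms(1) by simp
  qed
  then have "bounded (tangent_cell W v)"
    by (auto simp: bounded_iff)
  moreover have "tangent_cell W v = {g. v \<bullet> g = 0} \<inter> (\<Inter>x\<in>W. {g. x \<bullet> g \<le> 1 - x \<bullet> v})"
    by (auto simp: tangent_cell_def)
  then have "closed (tangent_cell W v)"
    by (auto intro!: closed_Int closed_INT closed_hyperplane closed_halfspace_le)
  ultimately show ?thesis by (simp add: compact_eq_bounded_closed)
qed

text \<open>The cell contains the disc of radius \<open>\<delta> / 2\<close>. With
  \<open>s = x \<bullet> v\<close>, Bessel's inequality bounds the square of
  \<open>x \<bullet> u\<close> by \<open>(1 + s) * (1 - s)\<close>, and separation makes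
  \<open>1 - s\<close> at least half the square of \<delta>; together they bound the square of the
  left side of the constraint by that of \<open>1 - s\<close>.\<close>

lemma small_tangent_in_cell:
  fixes W :: "'a::real_inner set"
  assumes W: "W \<subseteq> sphere 0 1" and v: "v \<in> W"
    and sep: "\<And>x. x \<in> W \<Longrightarrow> x \<noteq> v \<Longrightarrow> \<delta> \<le> dist x v"
    and u: "norm u = 1" "u \<bullet> v = 0" and "0 < \<delta>"
  shows "(\<delta> / 2) *\<^sub>R u \<in> tangent_cell W v"
proof -
  have nv: "norm v = 1" using W v by auto
  have "\<delta> / 2 * (x \<bullet> u) \<le> 1 - x \<bullet> v" if x: "x \<in> W" for x
  proof (cases "x = v")
    case True
    then show ?thesis using u nv by (simp add: inner_commute norm_eq_1)
  next
    case False
    have nx: "norm x = 1" using W x by auto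
    let ?s = "x \<bullet> v"
    have s: "?s \<le> 1" by (rule inner_unit_le[OF nx nv])
    have "\<delta>\<^sup>2 \<le> (dist x v)\<^sup>2"
      using sep[OF x False] \<open>0 < \<delta>\<close> by (intro power_mono) auto
    then have d: "\<delta>\<^sup>2 / 2 \<le> 1 - ?s"
      using inner_unit_dist[OF nx nv] by simp
    have "(x \<bullet> u)\<^sup>2 \<le> 1 - ?s\<^sup>2"
      using inner_orthonormal_pair_le[OF u(1) nv u(2), of x] nx by (simp add: inner_commute)
    then have "(\<delta> / 2 * (x \<bullet> u))\<^sup>2 \<le> (\<delta> / 2)\<^sup>2 * (1 - ?s\<^sup>2)"
      unfolding power_mult_distrib by (intro mult_left_mono) auto
    also have "\<dots> = (\<delta>\<^sup>2 / 2) * ((1 + ?s) / 2) * (1 - ?s)"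
      by (simp add: power2_eq_square field_simps)
    also have "\<dots> \<le> (\<delta>\<^sup>2 / 2) * 1 * (1 - ?s)"
      using s by (intro mult_right_mono mult_left_mono) auto
    also have "\<dots> = (\<delta>\<^sup>2 / 2) * (1 - ?s)" by simp
    also have "\<dots> \<le> (1 - ?s) * (1 - ?s)"
      using s d by (intro mult_right_mono) auto
    finally have "(\<delta> / 2 * (x \<bullet> u))\<^sup>2 \<le> (1 - ?s)\<^sup>2"
      by (simp only: power2_eq_square[of "1 - ?s"])
    then show ?thesis by (rule power2_le_imp_le) (use s in simp)
  qed
  then show ?thesis using u by (simp add: tangent_cell_def inner_commute)
qed

text \<open>Among the maximizers of \<open>u \<bullet> g\<close> on the cell, one of largest norm is a vertex.\<close>

lemma voronoi_vertex_in_direction: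
  fixes W :: "(real^3) set"
  assumes fin: "finite W" and W: "W \<subseteq> sphere 0 1" and v: "v \<in> W" and "0 < \<kappa>"
    and cover: "\<And>p. norm p = 1 \<Longrightarrow> \<exists>x\<in>W. \<kappa> \<le> p \<bullet> x"
    and "0 < \<delta>" and sep: "\<And>x. x \<in> W \<Longrightarrow> x \<noteq> v \<Longrightarrow> \<delta> \<le> dist x v"
    and u: "norm u = 1" "u \<bullet> v = 0"
  obtains p where "p \<in> voronoi_vertices W" "v \<in> contact W p" "\<delta> / 2 \<le> u \<bullet> (p /\<^sub>R (p \<bullet> v) - v)"
proof -
  let ?G = "tangent_cell W v"
  have nv: "norm v = 1" using W v by auto
  have comp: "compact ?G" by (rule compact_tangent_cell[OF nv v \<open>0 < \<kappa>\<close> cover])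
  have small: "(\<delta> / 2) *\<^sub>R u \<in> ?G"
    by (rule small_tangent_in_cell[OF W v sep u \<open>0 < \<delta>\<close>])
  have "continuous_on ?G (\<lambda>g. u \<bullet> g)" by (intro continuous_intros)
  then obtain g0 where g0: "g0 \<in> ?G" "\<And>g. g \<in> ?G \<Longrightarrow> u \<bullet> g \<le> u \<bullet> g0"
    using continuous_attains_sup[OF comp, of "\<lambda>g. u \<bullet> g"] small by blast
  let ?F = "?G \<inter> {g. u \<bullet> g = u \<bullet> g0}"
  have "compact ?F"
    by (intro compact_Int_closed comp closed_hyperplane)
  moreover have "continuous_on ?F norm" by (intro continuous_intros)
  moreover have "?F \<noteq> {}" using g0(1) by auto
  ultimately obtain g where g: "g \<in> ?F" "\<And>g'. g' \<in> ?F \<Longrightarrow> norm g' \<le> norm g"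
    using continuous_attains_sup[of ?F norm] by blast
  have gG: "g \<in> ?G" using g(1) by simp
  define p where "p = (v + g) /\<^sub>R norm (v + g)"
  note p = tangent_cell_contact[OF nv v gG, folded p_def]
  have vp: "v \<in> contact W p"
    using p(4) v nv gG by (simp add: tangent_cell_def norm_eq_1)
  have "3 \<le> card (contact W p)"
  proof (rule ccontr)
    assume few: "\<not> 3 \<le> card (contact W p)"
    have "finite (contact W p)" using fin p(4) by simp
    then have "card (contact W p - {v}) \<le> 1"
      using few vp by simp
    then obtain a where a: "contact W p - {v} \<subseteq> {a}"
      using \<open>finite (contact W p)\<close> by (metis card_le_Suc0_iff_eq finite_Diff insertCI subsetI One_nat_def)
    \<comment> \<open>With at most one contact \<open>a\<close> besides \<open>v\<close>, some
      \<open>d \<noteq> 0\<close> is orthogonal to both, so moving \<open>g\<close> along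
      \<open>d\<close> preserves the tight constraints.\<close>
    have "dim {v, a} \<le> card {v, a}" by (intro dim_le_card') auto
    also have "\<dots> \<le> 2" by (simp add: card_insert_if)
    finally have "dim {v, a} < DIM(real^3)" by simp
    then obtain d where d: "d \<noteq> 0" "\<And>y. y \<in> span {v, a} \<Longrightarrow> orthogonal d y"
      by (rule orthogonal_to_subspace_exists) blast
    have dva: "v \<bullet> d = 0" "a \<bullet> d = 0"
      using d(2)[of v] d(2)[of a] by (auto simp: orthogonal_def inner_commute span_base)
    \<comment> \<open>The step length \<open>t\<close> keeps the finitely many slack constraints
      valid; the summand 1 avoids a zero denominator.\<close>
    have "0 < (1 - x \<bullet> v - x \<bullet> g) / (1 + \<bar>x \<bullet> d\<bar>)" if "x \<in> W - contact W p" for x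
    proof (rule divide_pos_pos)
      have "x \<bullet> g \<le> 1 - x \<bullet> v" "x \<bullet> g \<noteq> 1 - x \<bullet> v"
        using that gG unfolding p(4) by (auto simp: tangent_cell_def)
      then show "0 < 1 - x \<bullet> v - x \<bullet> g" by linarith
    qed linarith
    then obtain t where t: "0 < t"
      "\<And>x. x \<in> W - contact W p \<Longrightarrow> t \<le> (1 - x \<bullet> v - x \<bullet> g) / (1 + \<bar>x \<bullet> d\<bar>)"
      using finite_positive_lower_bound[OF finite_Diff[OF fin],
          of "contact W p" "\<lambda>x. (1 - x \<bullet> v - x \<bullet> g) / (1 + \<bar>x \<bullet> d\<bar>)"] by blast
    have feas: "g + r *\<^sub>R d \<in> ?G" if r: "\<bar>r\<bar> = t" for r
    proof -
      have "x \<bullet> (g + r *\<^sub>R d) \<le> 1 - x \<bullet> v" if x: "x \<in> W" for x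
      proof (cases "x \<in> contact W p")
        case True
        then have "x \<bullet> d = 0" using a dva by auto
        then show ?thesis using gG x by (simp add: tangent_cell_def inner_simps)
      next
        case False
        have "r * (x \<bullet> d) \<le> t * \<bar>x \<bullet> d\<bar>"
          using r by (metis abs_ge_self abs_mult)
        also have "\<dots> \<le> t * (1 + \<bar>x \<bullet> d\<bar>)" using t(1) by (simp add: algebra_simps)
        also have "\<dots> \<le> 1 - x \<bullet> v - x \<bullet> g"
          using t(2)[of x] x False by (simp add: pos_le_divide_eq add_pos_nonneg)
        finally show ?thesis by (simp add: inner_simps)
      qed
      moreover have "v \<bullet> (g + r *\<^sub>R d) = 0"
        using gG dva by (simp add: tangent_cell_def inner_simps)
      ultimately show ?thesis by (simp add: tangent_cell_def)
    qed
    \<comment> \<open>Moves in both directions are feasible, so maximality forces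
      \<open>u \<bullet> d = 0\<close>, and the moved points are maximizers too.\<close>
    have "u \<bullet> (g + r *\<^sub>R d) \<le> u \<bullet> g" if "\<bar>r\<bar> = t" for r
      using g0(2)[OF feas[OF that]] g(1) by simp
    from this[of t] this[of "- t"] have "u \<bullet> d = 0"
      using t(1) by (auto simp: inner_simps mult_le_0_iff zero_le_mult_iff)
    then have "g + r *\<^sub>R d \<in> ?F" if "\<bar>r\<bar> = t" for r
      using feas[OF that] g(1) by (simp add: inner_simps)
    then have "(norm (g + r *\<^sub>R d))\<^sup>2 \<le> (norm g)\<^sup>2" if "\<bar>r\<bar> = t" for r
      using g(2) that by (intro power_mono) auto
    moreover have "(norm (g + r *\<^sub>R d))\<^sup>2 = (norm g)\<^sup>2 + 2 * r * (g \<bullet> d) + r * r * (d \<bullet> d)" for r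
      unfolding power2_norm_eq_inner by (simp add: inner_simps inner_commute)
    ultimately have le: "2 * r * (g \<bullet> d) + r * r * (d \<bullet> d) \<le> 0" if "\<bar>r\<bar> = t" for r
      using that by fastforce
    \<comment> \<open>Adding the inequalities for \<open>t\<close> and \<open>- t\<close> cancels
      the mixed term: the midpoint of a segment cannot have the largest norm.\<close>
    have "2 * t * (g \<bullet> d) + t * t * (d \<bullet> d) \<le> 0"
      using le[of t] t(1) by simp
    moreover have "2 * (- t) * (g \<bullet> d) + (- t) * (- t) * (d \<bullet> d) \<le> 0"
      by (rule le) (use t(1) in simp)
    ultimately have "t * t * (d \<bullet> d) \<le> 0" by linarith
    moreover have "0 < t * t * (d \<bullet> d)"
      using t(1) d(1) by (intro mult_pos_pos) auto
    ultimately show False by simp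
  qed
  then have "p \<in> voronoi_vertices W"
    using p(1) by (simp add: voronoi_vertices_def)
  moreover have "\<delta> / 2 \<le> u \<bullet> (p /\<^sub>R (p \<bullet> v) - v)"
    using g0(2)[OF small] g(1) u(1) unfolding p(3) by (simp add: norm_eq_1)
  ultimately show ?thesis using that vp by blast
qed

text \<open>Cauchy-Schwarz for \<open>u + w\<close> and \<open>g\<close>, where the squared norm of
  \<open>u + w\<close> is \<open>2 * (1 + u \<bullet> w)\<close>.\<close>

lemma inner_unit_ge_of_common_direction:
  fixes u w g :: "'a::real_inner"
  assumes "norm u = 1" "norm w = 1" "0 \<le> a" "a \<le> u \<bullet> g" "a \<le> w \<bullet> g"
  shows "2 * a\<^sup>2 \<le> (1 + u \<bullet> w) * (norm g)\<^sup>2"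
proof -
  have "(2 * a)\<^sup>2 \<le> ((u + w) \<bullet> g)\<^sup>2"
    using assms by (intro power_mono) (auto simp: inner_add_left)
  also have "\<dots> \<le> (norm (u + w) * norm g)\<^sup>2"
    using Cauchy_Schwarz_ineq2[of "u + w" g] by (simp add: abs_le_square_iff[symmetric])
  also have "\<dots> = 2 * ((1 + u \<bullet> w) * (norm g)\<^sup>2)"
    using assms(1,2) unfolding power_mult_distrib power2_norm_eq_inner[of "u + w"] norm_eq_1
    by (simp add: inner_simps inner_commute algebra_simps)
  finally show ?thesis by (simp add: power_mult_distrib)
qed

text \<open>The left side is the squared tangent of the angle between \<open>p\<close> and
  \<open>v\<close>.\<close>

lemma norm_tangent_point_le:
  fixes p v :: "'a::real_inner"
  assumes "norm p = 1" "norm v = 1" "0 < \<kappa>" "\<kappa> \<le> p \<bullet> v"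
  shows "(norm (p /\<^sub>R (p \<bullet> v) - v))\<^sup>2 \<le> 1 / \<kappa>\<^sup>2 - 1"
proof -
  let ?s = "p \<bullet> v"
  have s: "0 < ?s" using assms by simp
  have "(norm (p /\<^sub>R ?s - v))\<^sup>2 = 1 / ?s\<^sup>2 - 1"
    using assms(1,2) s unfolding power2_norm_eq_inner norm_eq_1
    by (simp add: inner_simps inner_commute power2_eq_square field_simps)
  moreover have "1 / ?s\<^sup>2 \<le> 1 / \<kappa>\<^sup>2"
    using assms by (intro divide_left_mono power_mono) auto
  ultimately show ?thesis by simp
qed

text \<open>The directions at \<open>v\<close> covered by one Voronoi vertex form an arc shorter than \<open>2 * pi / 5\<close>.\<close>

proposition six_voronoi_vertices:
  fixes W :: "(real^3) set"
  assumes fin: "finite W" and W: "W \<subseteq> sphere 0 1" and v: "v \<in> W" and "0 < \<kappa>"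
    and cover: "\<And>p. norm p = 1 \<Longrightarrow> \<exists>x\<in>W. \<kappa> \<le> p \<bullet> x"
    and "0 < \<delta>" and sep: "\<And>x. x \<in> W \<Longrightarrow> x \<noteq> v \<Longrightarrow> \<delta> \<le> dist x v"
    and ratio: "(cos (pi / 5))\<^sup>2 * (1 / \<kappa>\<^sup>2 - 1) < (\<delta> / 2)\<^sup>2"
  shows "6 \<le> card {p \<in> voronoi_vertices W. v \<in> contact W p}"
proof (rule ccontr)
  assume few: "\<not> ?thesis"
  let ?I = "{p \<in> voronoi_vertices W. v \<in> contact W p}"
  have nv: "norm v = 1" using W v by auto
  obtain e f :: "real^3" where ef: "norm e = 1" "norm f = 1" "e \<bullet> f = 0" "e \<bullet> v = 0" "f \<bullet> v = 0"
    using orthonormal_pair_orthogonal[OF nv] .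
  define u where "u t = cos t *\<^sub>R e + sin t *\<^sub>R f" for t
  have uu: "u s \<bullet> u t = cos (s - t)" for s t
    using ef(1-3) by (simp add: u_def inner_simps inner_commute norm_eq_1 cos_diff)
  have u: "norm (u t) = 1" "u t \<bullet> v = 0" for t
    using uu[of t t] ef(4,5) by (simp_all add: norm_eq_1) (simp add: u_def inner_simps)
  define g where "g p = p /\<^sub>R (p \<bullet> v) - v" for p
  \<comment> \<open>Directions in which the gnomonic image of \<open>p\<close> reaches the boundary
    of the inscribed disc or beyond.\<close>
  define T where "T p = {t. \<delta> / 2 \<le> u t \<bullet> g p}" for p
  have "0 < p \<bullet> x" if "\<kappa> \<le> p \<bullet> x" for p x :: "real^3"
    using that \<open>0 < \<kappa>\<close> by simp
  then have "\<exists>x\<in>W. 0 < p \<bullet> x" if "norm p = 1" for p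
    using cover[OF that] by blast
  then have "finite ?I"
    using finite_voronoi_vertices[OF fin W] by simp
  moreover have "card ?I \<le> 5" using few by simp
  moreover have "closed (T p)" for p
    unfolding T_def u_def by (intro closed_Collect_le continuous_intros)
  moreover have "\<exists>p\<in>?I. t \<in> T p" for t
  proof -
    obtain p where "p \<in> voronoi_vertices W" "v \<in> contact W p" "\<delta> / 2 \<le> u t \<bullet> (p /\<^sub>R (p \<bullet> v) - v)"
      using voronoi_vertex_in_direction[OF fin W v \<open>0 < \<kappa>\<close> cover \<open>0 < \<delta>\<close> sep u[of t]] .
    then show ?thesis by (auto simp: T_def g_def)
  qed
  moreover have "cos (2 * pi / 5) < cos (s - t)" if "p \<in> ?I" "s \<in> T p" "t \<in> T p" for p s t
  proof (rule ccontr)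
    assume "\<not> ?thesis"
    \<comment> \<open>Double angle formula: \<open>1 + cos (2 * pi / 5)\<close> is twice the square
      of \<open>cos (pi / 5)\<close>.\<close>
    then have "1 + u s \<bullet> u t \<le> 2 * (cos (pi / 5))\<^sup>2"
      unfolding uu by (simp add: cos_2pi_5)
    then have *: "(1 + u s \<bullet> u t) * (norm (g p))\<^sup>2 \<le> 2 * (cos (pi / 5))\<^sup>2 * (norm (g p))\<^sup>2"
      by (intro mult_right_mono) auto
    have p: "norm p = 1" "v \<in> contact W p"
      using that(1) by (auto simp: voronoi_vertices_def)
    obtain x where "x \<in> W" "\<kappa> \<le> p \<bullet> x" using cover[OF p(1)] by blast
    then have "\<kappa> \<le> p \<bullet> v" using contactD(2)[OF p(2)] by fastforce
    then have "(norm (g p))\<^sup>2 \<le> 1 / \<kappa>\<^sup>2 - 1"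
      unfolding g_def by (rule norm_tangent_point_le[OF p(1) nv \<open>0 < \<kappa>\<close>])
    then have "2 * (cos (pi / 5))\<^sup>2 * (norm (g p))\<^sup>2 \<le> 2 * (cos (pi / 5))\<^sup>2 * (1 / \<kappa>\<^sup>2 - 1)"
      by (intro mult_left_mono) auto
    also have "\<dots> < 2 * (\<delta> / 2)\<^sup>2" using ratio by simp
    also have "\<dots> \<le> (1 + u s \<bullet> u t) * (norm (g p))\<^sup>2"
      using that(2,3) \<open>0 < \<delta>\<close> u by (intro inner_unit_ge_of_common_direction) (auto simp: T_def)
    finally show False using * by simp
  qed
  ultimately show False by (rule circle_not_covered)
qed

section \<open>Mesh norm and separation\<close>

lemma finite_distances:
  assumes "finite W"
  shows "finite {dist x y | x y. x \<in> W \<and> y \<in> W \<and> x \<noteq> y}"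
  by (rule finite_subset[of _ "(\<lambda>(x, y). dist x y) ` (W \<times> W)"]) (use assms in auto)

lemma separation_le:
  assumes "finite W" "x \<in> W" "y \<in> W" "x \<noteq> y"
  shows "separation W \<le> dist x y"
  unfolding separation_def using assms by (intro Min_le finite_distances) auto

lemma separation_pos:
  assumes "2 \<le> card W"
  shows "0 < separation W"
proof -
  have fin: "finite W" using assms card.infinite by fastforce
  obtain x y where "x \<in> W" "y \<in> W" "x \<noteq> y"
    using assms card_le_Suc0_iff_eq[OF fin] by fastforce
  then have "{dist x y | x y. x \<in> W \<and> y \<in> W \<and> x \<noteq> y} \<noteq> {}" by blast
  then show ?thesis
    unfolding separation_def using finite_distances[OF fin] by (auto simp: Min_gr_iff)
qed

text \<open>The supremum is an upper bound because the distance to one fixed \<open>x0\<close>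
  bounds all the inner minima on the bounded set \<open>A\<close>.\<close>

lemma mesh_norm_cover:
  assumes "finite W" "W \<noteq> {}" "bounded A" "y \<in> A"
  obtains x where "x \<in> W" "dist y x \<le> mesh_norm W A"
proof -
  obtain x0 where x0: "x0 \<in> W" using assms(2) by blast
  obtain B where B: "\<And>z. z \<in> A \<Longrightarrow> dist x0 z \<le> B"
    using assms(3) bounded_any_center[of A x0] by blast
  have "(MIN x\<in>W. dist z x) \<le> B" if "z \<in> A" for z
  proof -
    have "(MIN x\<in>W. dist z x) \<le> dist z x0"
      using assms(1) x0 by (intro Min_le) auto
    then show ?thesis using B[OF that] by (simp add: dist_commute)
  qed
  then have "bdd_above ((\<lambda>z. MIN x\<in>W. dist z x) ` A)"
    by (intro bdd_aboveI2)
  then have "(MIN x\<in>W. dist y x) \<le> mesh_norm W A"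
    unfolding mesh_norm_def using assms(4) by (rule cSUP_upper[rotated])
  moreover have "(MIN x\<in>W. dist y x) \<in> (\<lambda>x. dist y x) ` W"
    using assms(1,2) by (intro Min_in) auto
  ultimately show ?thesis using that by auto
qed

section \<open>The golden ratio constant and the bound for fixed N\<close>

lemma cos_pi_5_pos: "0 < cos (pi / 5)"
proof (rule cos_gt_zero_pi)
  show "- (pi / 2) < pi / 5" using pi_gt_zero by linarith
qed simp

text \<open>For the angle pi/5 the triple and double angles add up to pi. The resulting cubic in the
  cosine has the root -1, and among the two remaining roots the bound \<open>?c > 1 / 2\<close>
  selects the right one.\<close>

lemma cos_pi_5: "cos (pi / 5) = (1 + sqrt 5) / 4"
proof -
  let ?c = "cos (pi / 5)"
  have c: "0 < ?c" using cos_pi_5_pos .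
  have "3 * (pi / 5) = pi - 2 * (pi / 5)" by simp
  then have "cos (3 * (pi / 5)) = - cos (2 * (pi / 5))"
    by (simp only: cos_pi_minus)
  then have "4 * ?c ^ 3 - 3 * ?c = - (2 * ?c\<^sup>2 - 1)"
    by (simp only: cos_treble_cos cos_double_cos)
  then have "(?c + 1) * (4 * ?c\<^sup>2 - 2 * ?c - 1) = 0" by algebra
  then have "?c + 1 = 0 \<or> 4 * ?c\<^sup>2 - 2 * ?c - 1 = 0" by (simp only: mult_eq_0_iff)
  then have "4 * ?c\<^sup>2 - 2 * ?c - 1 = 0" using c by linarith
  then have "(4 * ?c - 1)\<^sup>2 = 5" by algebra
  then have "\<bar>4 * ?c - 1\<bar> = sqrt 5" by (metis real_sqrt_abs)
  moreover have "?c > 1 / 2"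
    using cos_monotone_0_pi[of "pi / 5" "pi / 3"] by (simp add: cos_60)
  ultimately show ?thesis by (simp add: abs_if split: if_splits)
qed

text \<open>The numerator on the left, called \<kappa> below, is the cosine of the angle whose chord
  is the mesh norm; it accounts for the curvature of the sphere.\<close>

proposition mesh_ratio_ge:
  fixes W :: "(real^3) set"
  assumes card: "2 \<le> card W" and W: "W \<subseteq> sphere 0 1"
  shows "(1 - (mesh_norm W (sphere 0 1))\<^sup>2 / 2) / (2 * cos (pi / 5)) \<le> mesh_ratio W (sphere 0 1)"
proof (rule ccontr)
  define \<eta> where "\<eta> = mesh_norm W (sphere 0 1)"
  define \<delta> where "\<delta> = separation W"
  define \<kappa> where "\<kappa> = 1 - \<eta>\<^sup>2 / 2"
  let ?c = "cos (pi / 5)"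
  assume "\<not> ?thesis"
  then have lt: "\<eta> / \<delta> < \<kappa> / (2 * ?c)"
    by (simp add: \<eta>_def \<delta>_def \<kappa>_def mesh_ratio_def)
  have fin: "finite W" and ne: "W \<noteq> {}" using card card.infinite by fastforce+
  have \<delta>: "0 < \<delta>" unfolding \<delta>_def by (rule separation_pos[OF card])
  have near: "\<exists>x\<in>W. dist p x \<le> \<eta>" if "norm p = 1" for p
    using mesh_norm_cover[OF fin ne bounded_sphere, of p 0 1] that unfolding \<eta>_def by auto
  have c: "0 < ?c" using cos_pi_5_pos .
  have \<eta>: "0 \<le> \<eta>"
    using near[of "axis 1 1"] by (auto intro: order_trans[OF zero_le_dist])
  \<comment> \<open>Failure of the bound already forces \<kappa> to be positive, so every open
    hemisphere meets \<open>W\<close>.\<close>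
  then have "0 \<le> \<eta> / \<delta>" using \<delta> by simp
  then have "0 < \<kappa> / (2 * ?c)" using lt by linarith
  then have \<kappa>: "0 < \<kappa>" using c by (simp add: zero_less_divide_iff)
  have "?c * \<eta> / \<kappa> < \<delta> / 2"
    using lt \<delta> \<kappa> c by (simp add: field_simps)
  then have "(?c * \<eta> / \<kappa>)\<^sup>2 < (\<delta> / 2)\<^sup>2"
    using c \<eta> \<kappa> by (intro power_strict_mono) auto
  \<comment> \<open>Compares the squared tangent of the covering angle with the square of
    \<open>\<eta> / \<kappa>\<close>, its sine being at most its chord.\<close>
  moreover have "?c\<^sup>2 * (1 / \<kappa>\<^sup>2 - 1) \<le> (?c * \<eta> / \<kappa>)\<^sup>2"
  proof -
    have "1 - \<kappa>\<^sup>2 = \<eta>\<^sup>2 - (\<eta>\<^sup>2 / 2)\<^sup>2"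
      unfolding \<kappa>_def by (simp add: power2_eq_square algebra_simps)
    then have "1 - \<kappa>\<^sup>2 \<le> \<eta>\<^sup>2" by simp
    then have "(1 - \<kappa>\<^sup>2) / \<kappa>\<^sup>2 \<le> \<eta>\<^sup>2 / \<kappa>\<^sup>2"
      by (intro divide_right_mono) auto
    then have "1 / \<kappa>\<^sup>2 - 1 \<le> \<eta>\<^sup>2 / \<kappa>\<^sup>2"
      using \<kappa> by (simp add: diff_divide_distrib)
    then have "?c\<^sup>2 * (1 / \<kappa>\<^sup>2 - 1) \<le> ?c\<^sup>2 * (\<eta>\<^sup>2 / \<kappa>\<^sup>2)"
      by (intro mult_left_mono) auto
    then show ?thesis by (simp add: power_mult_distrib power_divide)
  qed
  ultimately have ratio: "?c\<^sup>2 * (1 / \<kappa>\<^sup>2 - 1) < (\<delta> / 2)\<^sup>2" by simp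
  have cover: "\<exists>x\<in>W. \<kappa> \<le> p \<bullet> x" if p: "norm p = 1" for p
  proof -
    obtain x where x: "x \<in> W" "dist p x \<le> \<eta>" using near[OF p] by blast
    then have "(dist p x)\<^sup>2 \<le> \<eta>\<^sup>2" by (intro power_mono) auto
    moreover have "norm x = 1" using W x(1) by auto
    ultimately show ?thesis
      using x(1) inner_unit_dist[OF p] by (intro bexI[of _ x]) (auto simp: \<kappa>_def)
  qed
  have pos: "\<exists>x\<in>W. 0 < p \<bullet> x" if "norm p = 1" for p
    using cover[OF that] \<kappa> by (meson less_le_trans)
  obtain v where v: "v \<in> W" "card {p \<in> voronoi_vertices W. v \<in> contact W p} \<le> 5"
    using few_voronoi_vertices[OF fin ne W pos] .
  have "\<delta> \<le> dist x v" if "x \<in> W" "x \<noteq> v" for x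
    unfolding \<delta>_def using separation_le[OF fin that(1) v(1) that(2)] .
  then have "6 \<le> card {p \<in> voronoi_vertices W. v \<in> contact W p}"
    using six_voronoi_vertices[OF fin W v(1) \<kappa> cover \<delta> _ ratio] by blast
  with v(2) show False by simp
qed

text \<open>Pigeonhole: once \<open>N\<close> exceeds the size of a finite net of radius
  \<open>\<epsilon> / 2\<close>, two points share a net point.\<close>

lemma separation_tendsto_0:
  fixes \<omega> :: "nat \<Rightarrow> 'a::metric_space set"
  assumes "compact A" "\<And>N. 2 \<le> N \<Longrightarrow> \<omega> N \<subseteq> A" "\<And>N. 2 \<le> N \<Longrightarrow> card (\<omega> N) = N"
  shows "(\<lambda>N. separation (\<omega> N)) \<longlonglongrightarrow> 0"
proof (rule tendstoI)
  fix \<epsilon> :: real assume "0 < \<epsilon>"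
  then obtain K where K: "finite K" "A \<subseteq> (\<Union>x\<in>K. ball x (\<epsilon> / 2))"
    using assms(1) unfolding compact_eq_totally_bounded by (meson half_gt_zero)
  show "\<forall>\<^sub>F N in sequentially. dist (separation (\<omega> N)) 0 < \<epsilon>"
  proof (rule eventually_sequentiallyI)
    fix N assume N: "max 2 (Suc (card K)) \<le> N"
    then have cN: "card (\<omega> N) = N" and sub: "\<omega> N \<subseteq> A" using assms(2,3) by auto
    have fin: "finite (\<omega> N)" using cN N card.infinite by fastforce
    obtain f where f: "\<And>x. x \<in> \<omega> N \<Longrightarrow> f x \<in> K \<and> dist (f x) x < \<epsilon> / 2"
      using K(2) sub by (simp add: subset_iff) metis
    have "f ` \<omega> N \<subseteq> K" using f by blast
    then have "\<not> inj_on f (\<omega> N)"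
      using card_inj_on_le[of f "\<omega> N" K] K(1) cN N by auto
    then obtain x y where xy: "x \<in> \<omega> N" "y \<in> \<omega> N" "x \<noteq> y" "f x = f y"
      by (auto simp: inj_on_def)
    have "dist x y < \<epsilon>"
      using f[OF xy(1)] f[OF xy(2)] xy(4) dist_triangle_half_r by metis
    then have "separation (\<omega> N) < \<epsilon>"
      using separation_le[OF fin xy(1-3)] by simp
    moreover have "0 < separation (\<omega> N)"
      using separation_pos[of "\<omega> N"] cN N by simp
    ultimately show "dist (separation (\<omega> N)) 0 < \<epsilon>" by simp
  qed
qed

theorem theorem5:
  fixes \<omega> :: "nat \<Rightarrow> (real ^ 3) set"
  assumes "\<And>N. N \<ge> 2 \<Longrightarrow> best_packing N (sphere 0 1) (\<omega> N)"
  shows "(\<exists>e :: nat \<Rightarrow> real. e \<in> o(\<lambda>_. 1) \<and>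
            (\<forall>N\<ge>2. mesh_ratio (\<omega> N) (sphere 0 1) \<ge> 1 / (2 * cos (pi / 5)) + e N))
         \<and> 1 / (2 * cos (pi / 5)) = 2 / (1 + sqrt 5)"
proof (intro conjI exI allI impI)
  define k where "k = 1 / (2 * cos (pi / 5))"
  have k: "0 < k" unfolding k_def by (simp add: cos_pi_5_pos)
  \<comment> \<open>If the ratio is below \<open>k\<close>, the mesh norm is less than
    \<open>k\<close> times the separation, and substituting this into \<open>mesh_ratio_ge\<close>
    gives this error term.\<close>
  let ?e = "\<lambda>N. - (k ^ 3 / 2 * (separation (\<omega> N))\<^sup>2)"
  have sub: "\<omega> N \<subseteq> sphere 0 1" and card: "card (\<omega> N) = N" if "2 \<le> N" for N
    using assms[OF that] by (simp_all add: best_packing_def)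
  have "(\<lambda>N. separation (\<omega> N)) \<longlonglongrightarrow> 0"
    using separation_tendsto_0[OF compact_sphere sub card] .
  then have "?e \<longlonglongrightarrow> - (k ^ 3 / 2 * 0\<^sup>2)"
    by (intro tendsto_intros)
  then show "?e \<in> o(\<lambda>_. 1)"
    by (intro smalloI_tendsto) auto
  fix N :: nat assume N: "2 \<le> N"
  define \<gamma> where "\<gamma> = mesh_ratio (\<omega> N) (sphere 0 1)"
  let ?\<delta> = "separation (\<omega> N)" and ?\<eta> = "mesh_norm (\<omega> N) (sphere 0 1)"
  have \<delta>: "0 < ?\<delta>" using separation_pos[of "\<omega> N"] card[OF N] N by simp
  have \<eta>: "?\<eta> = \<gamma> * ?\<delta>" using \<delta> by (simp add: \<gamma>_def mesh_ratio_def)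
  have ge: "k * (1 - ?\<eta>\<^sup>2 / 2) \<le> \<gamma>"
    using mesh_ratio_ge[OF _ sub[OF N]] card[OF N] N by (simp add: \<gamma>_def k_def)
  have "k + ?e N \<le> \<gamma>"
  proof (cases "k \<le> \<gamma>")
    case True
    moreover have "?e N \<le> 0" using k by simp
    ultimately show ?thesis by simp
  next
    case False
    moreover have "0 \<le> \<gamma>"
    proof -
      have "finite (\<omega> N)" "\<omega> N \<noteq> {}" using card[OF N] N card.infinite by fastforce+
      then obtain x where "dist (axis 1 1 :: real^3) x \<le> ?\<eta>"
        using mesh_norm_cover[OF _ _ bounded_sphere] by (metis dist_0_norm mem_sphere norm_axis_1)
      then have "0 \<le> ?\<eta>" using order_trans[OF zero_le_dist] by blast
      then show ?thesis using \<eta> \<delta> by (simp add: zero_le_mult_iff)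
    qed
    ultimately have "?\<eta>\<^sup>2 \<le> (k * ?\<delta>)\<^sup>2"
      unfolding \<eta> using \<delta> by (intro power_mono mult_right_mono) auto
    then have "k * (?\<eta>\<^sup>2 / 2) \<le> k * ((k * ?\<delta>)\<^sup>2 / 2)"
      using k by (intro mult_left_mono) auto
    also have "\<dots> = k ^ 3 / 2 * ?\<delta>\<^sup>2"
      by (simp add: power2_eq_square power3_eq_cube)
    finally show ?thesis
      using ge by (simp add: right_diff_distrib)
  qed
  then show "1 / (2 * cos (pi / 5)) + ?e N \<le> mesh_ratio (\<omega> N) (sphere 0 1)"
    by (simp add: k_def \<gamma>_def)
next
  have "0 < 1 + sqrt 5" by (simp add: add_pos_nonneg)
  then show "1 / (2 * cos (pi / 5)) = 2 / (1 + sqrt 5)"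
    unfolding cos_pi_5 by (simp add: field_simps)
qed

end
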